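(* Let $n$ be an integer with $n\geq 11$. (i) If $n\leq 37$: if $n\equiv 8\pmod{11}$ then $\gamma^{ID}(C_n(1,3)) = \lceil 4n/11\rceil+1$, and otherwise $\gamma^{ID}(C_n(1,3)) = \lceil 4n/11\rceil$. (ii) If $n \geq 38$: if $n\equiv 2,5,8\pmod{11}$ then $\gamma^{ID}(C_n(1,3)) = \lceil 4n/11\rceil+1$, and otherwise $\gamma^{ID}(C_n(1,3)) = \lceil 4n/11\rceil$.
   Context: For a positive integer $n$, the circulant graph $C_n(1,3)$ has vertex set $\mathbb{Z}_n$, and $u$ is adjacent to $u\pm1$ and $u\pm 3$ (modulo $n$); $N[u]=\{u,u\pm1,u\pm3\}$. For a code (nonempty subset) $C\subseteq\mathbb{Z}_n$, $I(C;u)=N[u]\cap C$. $C$ is identifying if $I(C;u)\neq\emptyset$ for all $u$ and $I(C;u)\ne I(C;v)$ for all distinct $u,v$. $\gamma^{ID}(G)$ is the minimum cardinality of an identifying code in $G$. *)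

theory Defs
  imports Complex_Main "HOL-Number_Theory.Cong"
begin

text \<open>A graph is given by a vertex set \<open>V\<close> and an adjacency relation \<open>E\<close>.\<close>

definition closed_nbhd :: "'a set \<Rightarrow> ('a \<Rightarrow> 'a \<Rightarrow> bool) \<Rightarrow> 'a \<Rightarrow> 'a set" where
  "closed_nbhd V E u = insert u {v \<in> V. E u v}"

definition I_set :: "'a set \<Rightarrow> ('a \<Rightarrow> 'a \<Rightarrow> bool) \<Rightarrow> 'a set \<Rightarrow> 'a \<Rightarrow> 'a set" where
  "I_set V E C u = closed_nbhd V E u \<inter> C"

definition identifying_code :: "'a set \<Rightarrow> ('a \<Rightarrow> 'a \<Rightarrow> bool) \<Rightarrow> 'a set \<Rightarrow> bool" where
  "identifying_code V E C \<longleftrightarrow>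
     C \<subseteq> V \<and> C \<noteq> {} \<and>
     (\<forall>u\<in>V. I_set V E C u \<noteq> {}) \<and>
     (\<forall>u\<in>V. \<forall>v\<in>V. u \<noteq> v \<longrightarrow> I_set V E C u \<noteq> I_set V E C v)"

text \<open>The value is unspecified when the graph has no finite identifying code. The
  finiteness conjunct matters only for infinite graphs, since infinite sets have
  \<open>card\<close> zero.\<close>

definition gamma_ID :: "'a set \<Rightarrow> ('a \<Rightarrow> 'a \<Rightarrow> bool) \<Rightarrow> nat" where
  "gamma_ID V E = (LEAST k. \<exists>C. identifying_code V E C \<and> finite C \<and> card C = k)"

text \<open>The vertices of \<open>C\<^sub>n(1,3)\<close> are the standard representatives of the residue
  classes modulo \<open>n\<close>.\<close>

definition circ_verts :: "nat \<Rightarrow> int set" where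
  "circ_verts n = {0..<int n}"

definition circ_adj :: "nat \<Rightarrow> int \<Rightarrow> int \<Rightarrow> bool" where
  "circ_adj n u v \<longleftrightarrow>
     [v = u + 1] (mod int n) \<or> [v = u - 1] (mod int n) \<or>
     [v = u + 3] (mod int n) \<or> [v = u - 3] (mod int n)"

end

theory Submission
  imports Defs
begin

text \<open>A code in \<open>C\<^sub>n(1,3)\<close> is an \<open>n\<close>-periodic bit sequence, and being identifying is a
  condition on its windows of length at most thirteen, so identifying codes are closed walks
  of length \<open>n\<close> in a finite graph of windows. Give a step the weight 7 if it adds a
  codeword and \<open>- 4\<close> otherwise, so that a closed walk with \<open>k\<close> codewords has weight
  \<open>11 k - 4 n\<close>. Potentials on the windows show that a closed walk through one particular
  window has weight 0 or at least 4, while a closed walk avoiding it has \<open>27 k \<ge> 10 n\<close>.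
  The weights 1, 2, 3 belong to the residues 8, 5, 2 of \<open>n\<close> modulo 11, and the second
  alternative admits them only for small \<open>n\<close>. Optimal codes repeat the block 11001100000
  after an initial word that depends on \<open>n\<close> modulo 11.\<close>

section \<open>Neighbourhoods as bit masks on windows\<close>

primrec meets :: "bool list \<Rightarrow> (int \<Rightarrow> bool) \<Rightarrow> int \<Rightarrow> bool" where
  "meets [] f i \<longleftrightarrow> False"
| "meets (b # bs) f i \<longleftrightarrow> b \<and> f i \<or> meets bs f (i + 1)"

text \<open>The offsets, counted from \<open>u - 3\<close>, of the vertices in \<open>N[u]\<close> and in the symmetric
  differences of \<open>N[u]\<close> and \<open>N[u + d]\<close> for \<open>d = 1, \<dots>, 6\<close>; for larger \<open>d\<close> the two
  neighbourhoods are disjoint.\<close>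

definition masks :: "bool list list" where
  "masks =
   [[True, False, True, True, True, False, True],
    [True, True, True, False, False, True, True, True],
    [True, False, False, True, False, True, False, False, True],
    [True, False, True, False, True, True, False, True, False, True],
    [True, False, True, True, False, False, False, True, True, False, True],
    [True, False, True, True, True, True, True, True, True, True, False, True],
    [True, False, True, True, True, False, False, False, True, True, True, False, True]]"

definition separating :: "(int \<Rightarrow> bool) \<Rightarrow> bool" where
  "separating f \<longleftrightarrow> (\<forall>m\<in>set masks. \<forall>i. meets m f i)"

text \<open>A window too short for the mask is undecided and counts as a hit.\<close>

fun hits :: "bool list \<Rightarrow> bool list \<Rightarrow> bool" where
  "hits [] xs = False"
| "hits (b # bs) [] = True"
| "hits (b # bs) (x # xs) = (if b \<and> x then True else hits bs xs)"

definition admissible :: "bool list \<Rightarrow> bool" where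
  "admissible xs \<longleftrightarrow> list_all (\<lambda>m. hits m xs) masks"

lemma hits_if_meets: "meets m f i \<Longrightarrow> hits m (map f [i..j])"
proof (induction m arbitrary: i)
  case (Cons b bs)
  show ?case
  proof (cases "i \<le> j")
    case True
    then have "[i..j] = i # [i+1..j]" by (rule upto_rec1)
    with Cons show ?thesis by auto
  qed simp
qed simp

lemma admissible_if_separating: "separating f \<Longrightarrow> admissible (map f [i..j])"
  by (auto simp: separating_def admissible_def list_all_iff intro: hits_if_meets)

section \<open>Weights of closed walks\<close>

text \<open>The potentials depend on the past bits and are stored in a decision tree that reads
  these bits backwards, most recent bit first. A leaf carries the least weight \<open>e\<close> of a walk
  from the distinguished leaf (the one with \<open>e = 0\<close> and \<open>d = 4\<close>), a lower bound \<open>d \<le> 4\<close> for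
  the excess of any other weight over \<open>e\<close>, and a potential \<open>p\<close> for the weight 27 per codeword
  minus 10 per step on walks that avoid the distinguished leaf. Leaves that cannot be reached
  from the distinguished one have \<open>e = 60\<close>.\<close>

datatype ctree = Leaf int int int | Node ctree ctree

primrec look :: "ctree \<Rightarrow> (int \<Rightarrow> bool) \<Rightarrow> int \<Rightarrow> int \<times> int \<times> int" where
  "look (Leaf e d p) f i = (e, d, p)"
| "look (Node l r) f i = (if f i then look r f (i - 1) else look l f (i - 1))"

text \<open>A weight equal to \<open>e\<close> exceeds \<open>e'\<close> by \<open>r\<close> after
  the step, a weight of at least \<open>e + d\<close> by at least \<open>d + r\<close>; the
  conditions on \<open>r\<close> restore the dichotomy for \<open>e'\<close> and \<open>d'\<close>.
  The last conjunct bounds the growth of \<open>p\<close> by 27 - 10 or - 10, except on steps that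
  touch the distinguished leaf.\<close>

fun edge_ok :: "bool \<Rightarrow> int \<times> int \<times> int \<Rightarrow> int \<times> int \<times> int \<Rightarrow> bool" where
  "edge_ok b (e, d, p) (e', d', p') \<longleftrightarrow>
     (let r = (if b then 7 else - 4) + e - e' in
      0 \<le> r \<and> d' \<le> d + r \<and> (r = 0 \<or> d' \<le> r) \<and>
      (e = 0 \<and> d = 4 \<or> e' = 0 \<and> d' = 4 \<or> p' \<le> p + (if b then 17 else - 10)))"

text \<open>The window \<open>xs\<close> ends with the bit \<open>b\<close> of the current step. It is extended into the
  past until the leaves before and after that step are both known; windows that no separating
  sequence contains are discarded.\<close>

fun explore :: "bool \<Rightarrow> bool list \<Rightarrow> ctree \<Rightarrow> ctree \<Rightarrow> bool" where
  "explore b xs (Leaf e d p) (Leaf e' d' p') = edge_ok b (e, d, p) (e', d', p')"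
| "explore b xs (Node l r) (Leaf e d p) =
     ((if admissible (False # xs) then explore b (False # xs) l (Leaf e d p) else True) \<and>
      (if admissible (True # xs) then explore b (True # xs) r (Leaf e d p) else True))"
| "explore b xs (Leaf e d p) (Node l r) =
     ((if admissible (False # xs) then explore b (False # xs) (Leaf e d p) l else True) \<and>
      (if admissible (True # xs) then explore b (True # xs) (Leaf e d p) r else True))"
| "explore b xs (Node l r) (Node l' r') =
     ((if admissible (False # xs) then explore b (False # xs) l l' else True) \<and>
      (if admissible (True # xs) then explore b (True # xs) r r' else True))"

text \<open>\<open>s\<close> and \<open>t\<close> are what remains of both descents, which resume at
  \<open>j - 1\<close>. Pruning is harmless because all windows of a separating sequence are
  admissible.\<close>

lemma explore_sound:
  assumes "explore b xs s t" and "separating f" and "xs = map f [j..i]" and "j \<le> i + 1"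
  shows "edge_ok b (look s f (j - 1)) (look t f (j - 1))"
  using assms
proof (induction b xs s t arbitrary: j rule: explore.induct)
  case (1 b xs e d p e' d' p')
  then show ?case by simp
next
  case (2 b xs l r e d p)
  have eq: "[j - 1..i] = (j - 1) # [j..i]" using 2 upto_rec1[of "j - 1" i] by simp
  have adm: "admissible (f (j - 1) # xs)"
    using admissible_if_separating[OF 2(4), of "j - 1" i] 2 by (simp add: eq)
  show ?case
    using 2(1)[of "j - 1"] 2(2)[of "j - 1"] 2(3-) adm by (cases "f (j - 1)") (simp_all add: eq)
next
  case (3 b xs e d p l r)
  have eq: "[j - 1..i] = (j - 1) # [j..i]" using 3 upto_rec1[of "j - 1" i] by simp
  have adm: "admissible (f (j - 1) # xs)"
    using admissible_if_separating[OF 3(4), of "j - 1" i] 3 by (simp add: eq)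
  show ?case
    using 3(1)[of "j - 1"] 3(2)[of "j - 1"] 3(3-) adm by (cases "f (j - 1)") (simp_all add: eq)
next
  case (4 b xs l r l' r')
  have eq: "[j - 1..i] = (j - 1) # [j..i]" using 4 upto_rec1[of "j - 1" i] by simp
  have adm: "admissible (f (j - 1) # xs)"
    using admissible_if_separating[OF 4(4), of "j - 1" i] 4 by (simp add: eq)
  show ?case
    using 4(1)[of "j - 1"] 4(2)[of "j - 1"] 4(3-) adm by (cases "f (j - 1)") (simp_all add: eq)
qed

text \<open>The entries act as a certificate, verified in \<open>explore_pasts\<close>. The
  distinguished leaf is the past 1100110000, the first ten bits of the optimal block.\<close>

definition pasts :: ctree where
  "pasts =
    Node (Node (Node (Node (Node (Node (Leaf (-1) 1 (-60)) (Node (Leaf 60 4 0) (Node (Leaf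
    (-4) 4 (-51)) (Leaf 3 1 (-50))))) (Node (Node (Leaf (-3) 1 (-60)) (Node (Leaf (-2) 1
    (-58)) (Leaf 4 1 (-42)))) (Node (Node (Node (Leaf 60 4 0) (Node (Leaf 1 1 (-51)) (Leaf 0 4
    0))) (Leaf 4 1 (-41))) (Node (Node (Node (Node (Leaf 60 4 0) (Node (Leaf 5 1 (-42)) (Leaf
    9 1 (-40)))) (Leaf 7 1 (-40))) (Leaf 11 1 (-40))) (Leaf 8 1 (-40)))))) (Node (Node (Node
    (Leaf 0 1 (-52)) (Node (Leaf 0 1 (-53)) (Leaf 1 1 (-50)))) (Node (Leaf 2 1 (-48)) (Node
    (Leaf 1 4 (-40)) (Leaf 8 1 (-32))))) (Node (Node (Node (Leaf 60 4 0) (Node (Leaf 5 1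
    (-41)) (Leaf 4 4 (-33)))) (Leaf 8 1 (-31))) (Node (Node (Node (Node (Leaf 5 1 (-39)) (Node
    (Leaf 9 1 (-32)) (Leaf 13 1 (-30)))) (Leaf 11 1 (-30))) (Leaf 15 1 (-30))) (Leaf 12 1
    (-30)))))) (Node (Node (Node (Node (Leaf 3 1 (-45)) (Leaf 4 1 (-42))) (Node (Node (Node
    (Leaf 3 1 (-45)) (Leaf 4 1 (-43))) (Leaf 4 1 (-41))) (Leaf 5 1 (-40)))) (Node (Leaf 6 1
    (-38)) (Node (Leaf 5 4 (-30)) (Leaf 12 1 (-22))))) (Node (Node (Node (Node (Node (Leaf 2 4
    (-37)) (Leaf 6 1 (-37))) (Leaf 7 1 (-34))) (Node (Leaf 9 1 (-31)) (Leaf 8 4 (-23)))) (Leaf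
    12 1 (-21))) (Node (Node (Node (Node (Leaf 9 1 (-29)) (Node (Leaf 13 1 (-22)) (Leaf 17 1
    (-20)))) (Leaf 15 1 (-20))) (Leaf 19 1 (-20))) (Leaf 16 1 (-20)))))) (Node (Node (Node
    (Node (Leaf 7 1 (-35)) (Node (Leaf 60 4 0) (Node (Leaf 7 1 (-34)) (Leaf 8 1 (-32)))))
    (Node (Node (Node (Leaf 7 1 (-35)) (Leaf 8 1 (-33))) (Leaf 8 1 (-31))) (Leaf 9 1 (-30))))
    (Node (Leaf 10 1 (-28)) (Node (Leaf 9 4 (-20)) (Leaf 16 1 (-12))))) (Node (Node (Node
    (Node (Node (Leaf 6 4 (-27)) (Leaf 10 1 (-27))) (Leaf 11 1 (-24))) (Node (Leaf 13 1 (-21))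
    (Leaf 12 4 (-13)))) (Leaf 16 1 (-11))) (Node (Node (Node (Node (Leaf 13 1 (-19)) (Node
    (Leaf 17 1 (-12)) (Leaf 21 1 (-10)))) (Leaf 19 1 (-10))) (Leaf 23 1 (-10))) (Leaf 20 1
    (-10)))))) (Node (Node (Node (Node (Node (Node (Leaf 6 1 (-43)) (Leaf 3 4 (-34))) (Node
    (Node (Leaf 4 1 (-43)) (Node (Leaf 5 1 (-41)) (Leaf 11 1 (-25)))) (Node (Leaf 7 1 (-34))
    (Leaf 12 1 (-25))))) (Node (Node (Leaf 7 1 (-36)) (Leaf 8 1 (-31))) (Node (Leaf 11 1
    (-24)) (Leaf 12 1 (-22))))) (Node (Node (Node (Node (Leaf 10 1 (-28)) (Leaf 11 1 (-25)))
    (Node (Leaf 10 1 (-28)) (Leaf 12 1 (-23)))) (Leaf 12 1 (-21))) (Node (Node (Node (Node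
    (Node (Leaf 9 4 (-20)) (Leaf 13 1 (-20))) (Leaf 14 1 (-17))) (Leaf 15 1 (-14))) (Leaf 19 1
    (-4))) (Leaf 16 1 (-12))))) (Node (Leaf 14 1 (-18)) (Node (Leaf 13 4 (-10)) (Leaf 20 1
    (-2))))) (Node (Node (Node (Node (Node (Node (Leaf 13 1 (-26)) (Leaf 10 4 (-17))) (Node
    (Leaf 11 1 (-26)) (Leaf 14 1 (-17)))) (Node (Node (Leaf 14 1 (-19)) (Leaf 15 1 (-14)))
    (Leaf 18 1 (-7)))) (Node (Leaf 17 1 (-11)) (Leaf 16 4 (-3)))) (Leaf 20 1 (-1))) (Node
    (Node (Node (Node (Leaf 17 1 (-9)) (Node (Leaf 21 1 (-2)) (Leaf 25 1 0))) (Leaf 23 1 0))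
    (Leaf 27 1 0)) (Leaf 24 1 0))))"

primrec children :: "ctree \<Rightarrow> bool \<Rightarrow> ctree" where
  "children (Leaf e d p) b = Leaf e d p"
| "children (Node l r) b = (if b then r else l)"

lemma explore_pasts:
  "explore False [False] pasts (children pasts False)"
  "explore True [True] pasts (children pasts True)"
  by code_simp+

lemma edge_ok_look:
  assumes "separating f"
  shows "edge_ok (f i) (look pasts f (i - 1)) (look pasts f i)"
proof -
  have "explore (f i) [f i] pasts (children pasts (f i))"
    using explore_pasts by (cases "f i") simp_all
  then have "edge_ok (f i) (look pasts f (i - 1)) (look (children pasts (f i)) f (i - 1))"
    by (rule explore_sound[OF _ assms, of _ _ _ _ i i]) simp_all
  moreover have "look (children pasts (f i)) f (i - 1) = look pasts f i"
  proof -
    obtain l r where "pasts = Node l r" by (simp add: pasts_def)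
    show ?thesis unfolding \<open>pasts = Node l r\<close> by (cases "f i") simp_all
  qed
  ultimately show ?thesis by simp
qed

lemma look_periodic:
  assumes "\<And>i. f (i + n) = f i"
  shows "look t f (i + n) = look t f i"
proof (induction t arbitrary: i)
  case (Node l r)
  have "look l f (i + n - 1) = look l f (i - 1)" "look r f (i + n - 1) = look r f (i - 1)"
    using Node.IH[of "i - 1"] by (simp_all add: algebra_simps)
  then show ?case by (simp add: assms)
qed simp

lemma sum_periodic:
  fixes g :: "int \<Rightarrow> 'a::ab_group_add"
  assumes "\<And>i. g (i + int n) = g i"
  shows "(\<Sum>t<n. g (i + int t)) = (\<Sum>t<n. g (int t))"
proof -
  have step: "(\<Sum>t<n. g (i + 1 + int t)) = (\<Sum>t<n. g (i + int t))" for i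
  proof -
    have "(\<Sum>t<Suc n. g (i + int t)) = g i + (\<Sum>t<n. g (i + 1 + int t))"
      by (simp add: sum.lessThan_Suc_shift add_ac del: sum.lessThan_Suc)
    then show ?thesis by (simp add: assms)
  qed
  show ?thesis
  proof (induction i rule: int_induct[where k = 0])
    case (step2 i)
    then show ?case using step[of "i - 1"] by simp
  qed (simp_all add: step)
qed

text \<open>Induction along the walk: \<open>edge_ok\<close> preserves the dichotomy, which holds at
  the distinguished leaf with weight 0.\<close>

lemma weight_gap:
  assumes "separating f" and "look pasts f i = (0, 4, p0)"
    and "look pasts f (i + int t) = (e, d, p)"
  shows "(\<Sum>s<t. 11 * of_bool (f (i + 1 + int s)) - 4) \<in> insert e {e + d..}"
  using assms(3)
proof (induction t arbitrary: e d p)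
  case 0
  then show ?case using assms(2) by simp
next
  case (Suc t)
  obtain e1 d1 p1 where l: "look pasts f (i + int t) = (e1, d1, p1)" by (metis prod_cases3)
  have "i + 1 + int t - 1 = i + int t" "i + int (Suc t) = i + 1 + int t" by simp_all
  with edge_ok_look[OF assms(1), of "i + 1 + int t"] l Suc.prems
  have "edge_ok (f (i + 1 + int t)) (e1, d1, p1) (e, d, p)" by argo
  with Suc.IH[OF l] show ?case by (cases "f (i + 1 + int t)") (auto simp: Let_def)
qed

text \<open>The potentials \<open>p\<close> telescope; the exemption in \<open>edge_ok\<close> never
  applies, as the distinguished leaf is avoided.\<close>

lemma weight_avoiding:
  assumes "separating f" and "\<And>i p. look pasts f i \<noteq> (0, 4, p)"
  shows "snd (snd (look pasts f (i + int t))) - snd (snd (look pasts f i))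
    \<le> (\<Sum>s<t. 27 * of_bool (f (i + 1 + int s)) - 10)"
proof (induction t)
  case (Suc t)
  obtain e1 d1 p1 where l1: "look pasts f (i + int t) = (e1, d1, p1)" by (metis prod_cases3)
  obtain e d p where l: "look pasts f (i + 1 + int t) = (e, d, p)" by (metis prod_cases3)
  have idx: "i + 1 + int t - 1 = i + int t" "i + int (Suc t) = i + 1 + int t" by simp_all
  with edge_ok_look[OF assms(1), of "i + 1 + int t"] l1 l
  have "edge_ok (f (i + 1 + int t)) (e1, d1, p1) (e, d, p)" by argo
  moreover have "\<not> (e1 = 0 \<and> d1 = 4)" "\<not> (e = 0 \<and> d = 4)" using assms(2) l1 l by auto
  ultimately have "p \<le> p1 + (if f (i + 1 + int t) then 17 else - 10)"
    by (simp add: Let_def)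
  with Suc.IH l1 l show ?case unfolding idx by (cases "f (i + 1 + int t)") simp_all
qed simp

lemma periodic_weight:
  assumes sep: "separating f" and per: "\<And>i. f (i + int n) = f i"
  defines "k \<equiv> \<Sum>t<n. of_bool (f (int t)) :: int"
  shows "11 * k = 4 * int n \<or> 4 * int n + 4 \<le> 11 * k \<or> 10 * int n \<le> 27 * k"
proof -
  have k: "(\<Sum>t<n. of_bool (f (i + 1 + int t))) = k" for i
    unfolding k_def by (rule sum_periodic) (simp add: per)
  show ?thesis
  proof (cases "\<exists>i p. look pasts f i = (0, 4, p)")
    case True
    then obtain i p where i: "look pasts f i = (0, 4, p)" by blast
    \<comment> \<open>A full period returns to the distinguished leaf, so its \<open>e = 0\<close>
      and \<open>d = 4\<close> govern the total weight.\<close>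
    then have "look pasts f (i + int n) = (0, 4, p)" by (simp add: look_periodic per)
    from weight_gap[OF sep i this]
    have "11 * k - 4 * int n \<in> insert 0 {4..}"
      by (simp add: sum_subtractf k mult.commute flip: sum_distrib_left)
    then show ?thesis by auto
  next
    case False
    then have "0 \<le> (\<Sum>s<n. 27 * of_bool (f (0 + 1 + int s)) - 10 :: int)"
      using weight_avoiding[OF sep, of 0 n] look_periodic[of f "int n" pasts 0] per by auto
    then show ?thesis
      using k[of 0] by (simp add: sum_subtractf flip: sum_distrib_left)
  qed
qed

section \<open>Identifying codes of the circulant graph as periodic sequences\<close>

definition steps :: "int set" where
  "steps = {- 3, - 1, 0, 1, 3}"

definition code_seq :: "nat \<Rightarrow> int set \<Rightarrow> int \<Rightarrow> bool" where
  "code_seq n C i \<longleftrightarrow> i mod int n \<in> C"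

lemma separating_iff:
  "separating f \<longleftrightarrow>
     (\<forall>u. (\<exists>x\<in>steps. f (u + x)) \<and>
        (\<forall>d\<in>{1..6}. \<exists>x\<in>(steps - (+) d ` steps) \<union> ((+) d ` steps - steps). f (u + x)))"
    (is "_ \<longleftrightarrow> (\<forall>u. ?P u)")
proof -
  have six: "{1..6} = {1, 2, 3, 4, 5, 6::int}" by auto
  have sd:
    "(steps - (+) 1 ` steps) \<union> ((+) 1 ` steps - steps) = {- 3, - 2, - 1, 2, 3, 4}"
    "(steps - (+) 2 ` steps) \<union> ((+) 2 ` steps - steps) = {- 3, 0, 2, 5}"
    "(steps - (+) 3 ` steps) \<union> ((+) 3 ` steps - steps) = {- 3, - 1, 1, 2, 4, 6}"
    "(steps - (+) 4 ` steps) \<union> ((+) 4 ` steps - steps) = {- 3, - 1, 0, 4, 5, 7}"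
    "(steps - (+) 5 ` steps) \<union> ((+) 5 ` steps - steps) = {- 3, - 1, 0, 1, 2, 3, 4, 5, 6, 8}"
    "(steps - (+) 6 ` steps) \<union> ((+) 6 ` steps - steps) = {- 3, - 1, 0, 1, 5, 6, 7, 9}"
    unfolding steps_def by auto
  \<comment> \<open>Masks count offsets from \<open>u - 3\<close>.\<close>
  have "?P (i + 3) \<longleftrightarrow> (\<forall>m\<in>set masks. meets m f i)" for i
    unfolding six masks_def by (simp add: sd) (simp add: steps_def add.commute)
  then have "(\<forall>i. ?P (i + 3)) \<longleftrightarrow> separating f" by (auto simp: separating_def)
  moreover have "(\<forall>i. ?P (i + 3)) \<longleftrightarrow> (\<forall>u. ?P u)" by (metis diff_add_cancel)
  ultimately show ?thesis by simp
qed

lemma I_set_circ: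
  assumes "0 < n" and "C \<subseteq> circ_verts n"
  shows "I_set (circ_verts n) (circ_adj n) C (u mod int n)
    = (\<lambda>x. (u + x) mod int n) ` {x \<in> steps. code_seq n C (u + x)}"
proof -
  have "v \<in> closed_nbhd (circ_verts n) (circ_adj n) (u mod int n)
      \<longleftrightarrow> (\<exists>x\<in>steps. v = (u + x) mod int n)" if "v \<in> circ_verts n" for v
  proof -
    have v: "v mod int n = v" using that assms(1) by (simp add: circ_verts_def)
    then show ?thesis using that
      by (auto simp: closed_nbhd_def circ_adj_def steps_def cong_def mod_simps)
  qed
  then show ?thesis using assms(2)
    by (fastforce simp: I_set_def code_seq_def)
qed

lemma code_seq_periodic: "code_seq n C (i + int n) = code_seq n C i"
  by (simp add: code_seq_def)

lemma card_code_seq: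
  assumes "C \<subseteq> circ_verts n"
  shows "int (card C) = (\<Sum>t<n. of_bool (code_seq n C (int t)))"
proof -
  have "C = int ` {t\<in>{..<n}. code_seq n C (int t)}"
  proof (intro set_eqI iffI)
    fix c assume "c \<in> C"
    moreover from this assms have "0 \<le> c" "c < int n" by (auto simp: circ_verts_def)
    ultimately show "c \<in> int ` {t\<in>{..<n}. code_seq n C (int t)}"
      by (intro image_eqI[where x = "nat c"]) (auto simp: code_seq_def nat_less_iff)
  qed (auto simp: code_seq_def)
  then have "card C = card {t\<in>{..<n}. code_seq n C (int t)}"
    by (metis card_image inj_on_of_nat)
  then show ?thesis by (simp add: sum.If_cases of_bool_def Int_def)
qed

text \<open>Wrapping around only makes neighbourhoods overlap more, so a codeword that separates two
  vertices comes from an offset in the symmetric difference; \<open>7 \<le> n\<close> keeps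
  \<open>u\<close> and \<open>u + d\<close> distinct.\<close>

lemma separating_if_identifying:
  assumes "7 \<le> n" and "identifying_code (circ_verts n) (circ_adj n) C"
  shows "separating (code_seq n C)"
  unfolding separating_iff
proof (intro allI conjI ballI)
  have n: "0 < n" and C: "C \<subseteq> circ_verts n"
    using assms by (auto simp: identifying_code_def)
  note I = I_set_circ[OF n C]
  have V: "u mod int n \<in> circ_verts n" for u using n by (simp add: circ_verts_def)
  fix u
  show "\<exists>x\<in>steps. code_seq n C (u + x)"
    using assms(2) V[of u] I[of u] unfolding identifying_code_def by fastforce
  fix d :: int assume d: "d \<in> {1..6}"
  have "u mod int n \<noteq> (u + d) mod int n"
  proof
    assume "u mod int n = (u + d) mod int n"
    then have "int n dvd (u + d) - u" by (metis mod_eq_dvd_iff)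
    then show False using d assms(1) by (auto dest: zdvd_imp_le)
  qed
  then have "I_set (circ_verts n) (circ_adj n) C (u mod int n)
      \<noteq> I_set (circ_verts n) (circ_adj n) C ((u + d) mod int n)"
    using assms(2) V unfolding identifying_code_def by blast
  then consider
      x where "x \<in> steps" "code_seq n C (u + x)"
        "(u + x) mod int n \<notin> I_set (circ_verts n) (circ_adj n) C ((u + d) mod int n)"
    | x where "x \<in> steps" "code_seq n C (u + d + x)"
        "(u + d + x) mod int n \<notin> I_set (circ_verts n) (circ_adj n) C (u mod int n)"
    unfolding I by blast
  then show "\<exists>x\<in>(steps - (+) d ` steps) \<union> ((+) d ` steps - steps). code_seq n C (u + x)"
  proof cases
    case (1 x)
    have "x \<notin> (+) d ` steps"
    proof
      assume "x \<in> (+) d ` steps"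
      then obtain y where "y \<in> steps" "x = d + y" by blast
      with 1 show False unfolding I by (auto simp: add_ac)
    qed
    with 1 show ?thesis by blast
  next
    case (2 x)
    have "d + x \<notin> steps"
    proof
      assume "d + x \<in> steps"
      with 2 show False unfolding I by (auto simp: add.assoc)
    qed
    with 2 show ?thesis by (intro bexI[of _ "d + x"]) (auto simp: add_ac)
  qed
qed

text \<open>For \<open>d \<le> 6\<close> the compared offsets differ by at most 3 + 6 + 3 = 12 < n,
  so congruent offsets are equal.\<close>

lemma identifying_if_separating:
  assumes "13 \<le> n" and C: "C \<subseteq> circ_verts n" and sep: "separating (code_seq n C)"
  shows "identifying_code (circ_verts n) (circ_adj n) C"
proof -
  let ?I = "\<lambda>u. I_set (circ_verts n) (circ_adj n) C (u mod int n)"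
  have n: "0 < n" using assms by simp
  note I = I_set_circ[OF n C]
  have bound: "\<bar>x\<bar> \<le> 3" if "x \<in> steps" for x using that by (auto simp: steps_def)
  have zero: "z = 0" if "(u + z) mod int n = u mod int n" "\<bar>z\<bar> < int n" for u z
  proof -
    have "int n dvd (u + z) - u" using that(1) by (metis mod_eq_dvd_iff)
    then show "z = 0" using that(2) dvd_imp_le_int[of z "int n"] by auto
  qed
  have ne: "?I u \<noteq> {}" for u
    using sep unfolding separating_iff I by blast
  have near: "?I u \<noteq> ?I (u + d)" if d: "1 \<le> d" "d \<le> 6" for u d
  proof -
    from sep d obtain x where
      x: "x \<in> (steps - (+) d ` steps) \<union> ((+) d ` steps - steps)" "code_seq n C (u + x)"
      unfolding separating_iff by (metis atLeastAtMost_iff)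
    from x(1) show ?thesis
    proof
      assume a: "x \<in> steps - (+) d ` steps"
      have "(u + x) mod int n \<notin> ?I (u + d)"
      proof
        assume "(u + x) mod int n \<in> ?I (u + d)"
        then obtain y where y: "y \<in> steps" "(u + x) mod int n = (u + d + y) mod int n"
          unfolding I by auto
        then have "(u + d + y + (x - d - y)) mod int n = (u + d + y) mod int n"
          by (simp add: algebra_simps)
        moreover have "\<bar>x - d - y\<bar> < int n" using bound[of x] bound[of y] a y d assms(1) by auto
        ultimately have "x - d - y = 0" by (rule zero)
        then show False using a y by (auto simp: image_iff)
      qed
      moreover have "(u + x) mod int n \<in> ?I u" using a x(2) unfolding I by auto
      ultimately show ?thesis by metis
    next
      assume a: "x \<in> (+) d ` steps - steps"
      then obtain z where z: "z \<in> steps" "x = d + z" by blast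
      have "(u + x) mod int n \<notin> ?I u"
      proof
        assume "(u + x) mod int n \<in> ?I u"
        then obtain y where y: "y \<in> steps" "(u + x) mod int n = (u + y) mod int n"
          unfolding I by auto
        then have "(u + y + (x - y)) mod int n = (u + y) mod int n"
          by (simp add: algebra_simps)
        moreover have "\<bar>x - y\<bar> < int n" using bound[of z] bound[of y] z y d assms(1) by auto
        ultimately have "x - y = 0" by (rule zero)
        then show False using a y by auto
      qed
      moreover have "(u + x) mod int n \<in> ?I (u + d)" using z x(2) unfolding I
        by (auto simp: add_ac)
      ultimately show ?thesis by metis
    qed
  qed
  \<comment> \<open>\<open>d + y - x\<close> lies strictly between 0 and n, so the neighbourhoods
    are disjoint, while the traces on \<open>C\<close> are nonempty.\<close>
  have apart: "?I u \<noteq> ?I (u + d)" if d: "7 \<le> d" "d \<le> int n - 7" for u d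
  proof
    assume eq: "?I u = ?I (u + d)"
    from ne[of u] obtain x where x: "x \<in> steps" "(u + x) mod int n \<in> ?I u"
      unfolding I by blast
    from x(2) obtain y where "y \<in> steps" "(u + x) mod int n = (u + d + y) mod int n"
      unfolding eq unfolding I by blast
    with x(1) have "(u + x + (d + y - x)) mod int n = (u + x) mod int n"
        and "\<bar>x\<bar> \<le> 3" "\<bar>y\<bar> \<le> 3"
      by (auto simp: algebra_simps intro: bound)
    moreover from this d have "\<bar>d + y - x\<bar> < int n" "d + y - x \<noteq> 0" by arith+
    ultimately show False using zero[of "u + x" "d + y - x"] by blast
  qed
  have dist: "?I u \<noteq> ?I v" if "0 \<le> u" "u < v" "v < int n" for u v
  proof -
    consider "v - u \<le> 6" | "7 \<le> v - u" "v - u \<le> int n - 7" | "int n - 6 \<le> v - u" by linarith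
    then show ?thesis
    proof cases
      case 1 then show ?thesis using near[of "v - u" u] that by simp
    next
      case 2 then show ?thesis using apart[of "v - u" u] by simp
    next
      case 3
      \<comment> \<open>Around the cycle, \<open>u\<close> lies at most 6 ahead of
        \<open>v\<close>.\<close>
      have "?I v \<noteq> ?I (v + (int n - (v - u)))" using 3 that by (intro near) auto
      then show ?thesis by (simp add: algebra_simps)
    qed
  qed
  have "I_set (circ_verts n) (circ_adj n) C u \<noteq> I_set (circ_verts n) (circ_adj n) C v"
    if "u \<in> circ_verts n" "v \<in> circ_verts n" "u \<noteq> v" for u v
    using dist[of u v] dist[of v u] that by (cases "u < v") (auto simp: circ_verts_def)
  moreover have "I_set (circ_verts n) (circ_adj n) C u \<noteq> {}" if "u \<in> circ_verts n" for u
    using ne[of u] that by (simp add: circ_verts_def)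
  moreover have "C \<noteq> {}" using ne[of 0] by (auto simp: I_set_def)
  ultimately show ?thesis using C by (auto simp: identifying_code_def)
qed

section \<open>Cyclic words\<close>

text \<open>Masks that overhang the end count as hit, so only complete windows constrain the
  word.\<close>

primrec windows :: "bool list \<Rightarrow> bool" where
  "windows [] \<longleftrightarrow> True"
| "windows (x # xs) \<longleftrightarrow> admissible (x # xs) \<and> windows xs"

text \<open>Twelve bits of overlap show every window of length 13 of the periodic sequence.\<close>

definition cyclic_word :: "bool list \<Rightarrow> bool" where
  "cyclic_word w \<longleftrightarrow> 12 \<le> length w \<and> windows (drop (length w - 12) w @ w)"

definition word_seq :: "bool list \<Rightarrow> int \<Rightarrow> bool" where
  "word_seq w i \<longleftrightarrow> w ! nat (i mod int (length w))"

lemma length_masks: "m \<in> set masks \<Longrightarrow> length m \<le> 13"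
  by (auto simp: masks_def)

lemma hits_append: "hits m xs \<Longrightarrow> length m \<le> length xs \<Longrightarrow> hits m (xs @ ys)"
  by (induction m xs rule: hits.induct) auto

text \<open>The length bound rules out the undecided case of \<open>hits\<close>.\<close>

lemma meets_if_hits:
  "hits m xs \<Longrightarrow> length m \<le> length xs \<Longrightarrow> (\<And>k. k < length xs \<Longrightarrow> f (i + int k) = xs ! k)
    \<Longrightarrow> meets m f i"
proof (induction m xs arbitrary: i rule: hits.induct)
  case (3 b bs x xs)
  have "f i = x" using 3(4)[of 0] by simp
  moreover have "f (i + 1 + int k) = xs ! k" if "k < length xs" for k
    using 3(4)[of "Suc k"] that by (simp add: add_ac)
  ultimately show ?case using 3 by (auto split: if_splits)
qed auto

text \<open>A mask that starts in \<open>xs\<close> ends within \<open>xs @ ys\<close>, having at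
  most 13 bits; later starts are covered by \<open>ys @ zs\<close>.\<close>

lemma windows_append:
  assumes "windows (xs @ ys)" and "windows (ys @ zs)" and "12 \<le> length ys"
  shows "windows (xs @ ys @ zs)"
  using assms(1)
proof (induction xs)
  case (Cons x xs)
  have "hits m ((x # xs @ ys) @ zs)" if "m \<in> set masks" for m
    using that Cons.prems length_masks[OF that] assms(3)
    by (intro hits_append) (auto simp: admissible_def list_all_iff)
  with Cons show ?case by (simp add: admissible_def list_all_iff)
qed (simp add: assms)

lemma windows_drop: "windows xs \<Longrightarrow> k < length xs \<Longrightarrow> admissible (drop k xs)"
proof (induction xs arbitrary: k)
  case (Cons x xs)
  then show ?case by (cases k) auto
qed simp

lemma separating_word_seq:
  assumes "cyclic_word w"
  shows "separating (word_seq w)"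
  unfolding separating_def
proof (intro ballI allI)
  fix m i
  assume m: "m \<in> set masks"
  define n where "n = length w"
  define xs where "xs = drop (n - 12) w @ w"
  \<comment> \<open>Twelve bits precede the word in \<open>xs\<close>, so index \<open>i\<close> of
    the sequence appears at \<open>q\<close>, with at least 13 bits from there on.\<close>
  define q where "q = nat ((i + 12) mod int n)"
  have n: "12 \<le> n" and win: "windows xs" using assms by (simp_all add: cyclic_word_def n_def xs_def)
  have len: "length xs = n + 12" using n by (simp add: xs_def n_def)
  have q: "int q = (i + 12) mod int n" using n by (simp add: q_def)
  have qn: "q < n" using n by (simp add: q_def nat_less_iff)
  have xs_nth: "xs ! k = word_seq w (int k - 12)" if "k < n + 12" for k
  proof (cases "k < 12")
    case True
    have "(int k - 12) mod int n = (int k - 12 + int n) mod int n" by simp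
    also have "\<dots> = int k - 12 + int n" using True n by (intro mod_pos_pos_trivial) auto
    finally have "nat ((int k - 12) mod int n) = n - 12 + k" using n by linarith
    then show ?thesis using True n by (simp add: xs_def word_seq_def nth_append n_def)
  next
    case False
    then have "nat ((int k - 12) mod int n) = k - 12" using that by simp
    then show ?thesis using False n by (simp add: xs_def word_seq_def nth_append n_def)
  qed
  have "admissible (drop q xs)" using windows_drop[OF win] qn len by simp
  then have "hits m (drop q xs)" using m by (simp add: admissible_def list_all_iff)
  moreover have "length m \<le> length (drop q xs)" using length_masks[OF m] len qn by simp
  moreover have "word_seq w (i + int k) = drop q xs ! k" if "k < length (drop q xs)" for k
  proof -
    have "(int (q + k) - 12) mod int n = (int q + (int k - 12)) mod int n"
      by (simp add: algebra_simps)
    also have "\<dots> = (i + int k) mod int n" unfolding q by (simp add: mod_simps)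
    finally show ?thesis using xs_nth[of "q + k"] that len by (simp add: word_seq_def n_def)
  qed
  ultimately show "meets m (word_seq w) i" by (rule meets_if_hits)
qed

definition has_code :: "nat \<Rightarrow> nat \<Rightarrow> bool" where
  "has_code n k \<longleftrightarrow>
     (\<exists>C. identifying_code (circ_verts n) (circ_adj n) C \<and> card C = k)"

lemma has_code_if_cyclic:
  assumes "cyclic_word w" and "13 \<le> length w"
  shows "has_code (length w) (length (filter id w))"
proof -
  define C where "C = int ` {i. i < length w \<and> id (w ! i)}"
  have pos: "0 < int (length w)" using assms(2) by linarith
  have "nat (i mod int (length w)) < length w" for i
    using pos_mod_bound[OF pos, of i] pos by linarith
  moreover have "i mod int (length w) \<ge> 0" for i using pos by (rule pos_mod_sign)
  ultimately have "code_seq (length w) C = word_seq w"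
    by (fastforce simp: fun_eq_iff code_seq_def word_seq_def C_def image_iff)
  then have "identifying_code (circ_verts (length w)) (circ_adj (length w)) C"
    using assms separating_word_seq
    by (intro identifying_if_separating) (auto simp: C_def circ_verts_def)
  moreover have "card C = length (filter id w)"
    unfolding C_def length_filter_conv_card by (intro card_image) simp
  ultimately show ?thesis unfolding has_code_def by blast
qed

section \<open>Words extendable by the block\<close>

abbreviation bits :: "nat list \<Rightarrow> bool list" where
  "bits \<equiv> map (\<lambda>b. b = 1)"

definition block :: "bool list" where
  "block = bits [1, 1, 0, 0, 1, 1, 0, 0, 0, 0, 0]"

text \<open>The last twelve bits of \<open>block @ block\<close>. Closed words can be concatenated, since
  windows have at most thirteen bits.\<close>

definition border :: "bool list" where
  "border = bits [0, 1, 1, 0, 0, 1, 1, 0, 0, 0, 0, 0]"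

definition closed_word :: "bool list \<Rightarrow> bool" where
  "closed_word w \<longleftrightarrow> windows (border @ w) \<and> drop (length w - 12) w = border"

lemma border_block:
  "windows (border @ block)" "drop 11 (border @ block) = border"
  "length border = 12" "length block = 11" "length (filter id block) = 4"
  by code_simp+

lemma cyclic_if_closed:
  assumes "closed_word w"
  shows "cyclic_word w"
proof -
  \<comment> \<open>Subtraction is truncated: a word shorter than twelve bits would be its own
    suffix, too short to equal \<open>border\<close>.\<close>
  have "length (drop (length w - 12) w) = 12" using assms by (simp add: closed_word_def border_block)
  then have "12 \<le> length w" by simp
  then show ?thesis using assms by (simp add: closed_word_def cyclic_word_def)
qed

lemma closed_append_block:
  assumes "closed_word w"
  shows "closed_word (w @ block)"
proof -
  define v where "v = take (length w - 12) w"
  have w: "w = v @ border" using assms unfolding v_def closed_word_def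
    by (metis append_take_drop_id)
  have "windows ((border @ v) @ border @ block)"
    using assms by (intro windows_append) (auto simp: closed_word_def w border_block)
  moreover have "drop (length v + 11) (v @ border @ block) = border"
    by (simp only: drop_append) (use border_block in simp)
  ultimately show ?thesis by (simp add: closed_word_def w border_block)
qed

text \<open>Each block adds 11 vertices and 4 codewords, leaving the weight unchanged.\<close>

lemma has_code_if_closed:
  assumes "closed_word w" and "13 \<le> length w"
  shows "has_code (length w + 11 * k) (length (filter id w) + 4 * k)"
proof -
  have "\<exists>v. closed_word v \<and> length v = length w + 11 * k
    \<and> length (filter id v) = length (filter id w) + 4 * k"
  proof (induction k)
    case (Suc k)
    then obtain v where v: "closed_word v" "length v = length w + 11 * k"
      "length (filter id v) = length (filter id w) + 4 * k" by blast
    have "length (v @ block) = length w + 11 * Suc k"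
      by (simp add: v(2) border_block(4))
    moreover have "length (filter id (v @ block)) = length (filter id w) + 4 * Suc k"
      unfolding filter_append length_append v(3) border_block(5) by simp
    ultimately show ?case using closed_append_block[OF v(1)] by blast
  qed (use assms in auto)
  then show ?thesis using has_code_if_cyclic[OF cyclic_if_closed] assms(2)
    by (metis trans_le_add1)
qed

section \<open>Lengths 11 and 12\<close>

text \<open>Keeping the order of \<open>cs\<close> turns equality of the sets I(C;u) into equality
  of lists, which can be computed.\<close>

definition signature :: "nat \<Rightarrow> int list \<Rightarrow> int \<Rightarrow> int list" where
  "signature n cs u = filter (\<lambda>c. list_ex (\<lambda>x. (u + x) mod int n = c) [- 3, - 1, 0, 1, 3]) cs"

text \<open>Needed for \<open>n = 11\<close> and \<open>n = 12\<close>, where a window of length 13 wraps around the cycle.\<close>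

lemma identifying_by_signature:
  assumes "0 < n" and C: "set cs \<subseteq> circ_verts n" and "cs \<noteq> []"
    and ne: "[] \<notin> signature n cs ` circ_verts n"
    and inj: "inj_on (signature n cs) (circ_verts n)"
  shows "identifying_code (circ_verts n) (circ_adj n) (set cs)"
proof -
  have I: "I_set (circ_verts n) (circ_adj n) (set cs) u = set (signature n cs u)"
    if "u \<in> circ_verts n" for u
  proof -
    have u: "u mod int n = u" using that by (simp add: circ_verts_def)
    have st: "set [- 3, - 1, 0, 1, 3] = steps" by (simp add: steps_def)
    have "set (signature n cs u) = {c \<in> set cs. \<exists>x\<in>steps. (u + x) mod int n = c}"
      unfolding signature_def set_filter list_ex_iff st ..
    then show ?thesis using I_set_circ[OF assms(1) C, of u] unfolding u code_seq_def by auto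
  qed
  have filter_eq: "filter P cs = filter Q cs" if "set (filter P cs) = set (filter Q cs)" for P Q
    using that by (intro filter_cong) auto
  have "signature n cs u = signature n cs v"
    if "set (signature n cs u) = set (signature n cs v)" for u v
    using that unfolding signature_def by (rule filter_eq)
  with inj have "set (signature n cs u) \<noteq> set (signature n cs v)"
    if "u \<in> circ_verts n" "v \<in> circ_verts n" "u \<noteq> v" for u v
    using that by (metis inj_onD)
  moreover have "set (signature n cs u) \<noteq> {}" if "u \<in> circ_verts n" for u
    using that ne by (metis image_eqI set_empty)
  ultimately show ?thesis using C \<open>cs \<noteq> []\<close> by (simp add: identifying_code_def I)
qed

lemma has_code_11: "has_code 11 4"
proof -
  have V: "circ_verts 11 = set [0..10]" by (auto simp: circ_verts_def)
  \<comment> \<open>The positions of the ones in \<open>block\<close>.\<close>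
  have "identifying_code (circ_verts 11) (circ_adj 11) (set [0, 1, 4, 5])"
  proof (rule identifying_by_signature)
    show "[] \<notin> signature 11 [0, 1, 4, 5] ` circ_verts 11" unfolding V by code_simp
    have "distinct (map (signature 11 [0, 1, 4, 5]) [0..10])" by code_simp
    then show "inj_on (signature 11 [0, 1, 4, 5]) (circ_verts 11)"
      unfolding V by (simp only: distinct_map)
  qed (auto simp: circ_verts_def)
  then show ?thesis unfolding has_code_def by (intro exI) auto
qed

lemma has_code_12: "has_code 12 5"
proof -
  have V: "circ_verts 12 = set [0..11]" by (auto simp: circ_verts_def)
  have "identifying_code (circ_verts 12) (circ_adj 12) (set [0, 1, 2, 5, 6])"
  proof (rule identifying_by_signature)
    show "[] \<notin> signature 12 [0, 1, 2, 5, 6] ` circ_verts 12" unfolding V by code_simp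
    have "distinct (map (signature 12 [0, 1, 2, 5, 6]) [0..11])" by code_simp
    then show "inj_on (signature 12 [0, 1, 2, 5, 6]) (circ_verts 12)"
      unfolding V by (simp only: distinct_map)
  qed (auto simp: circ_verts_def)
  then show ?thesis unfolding has_code_def by (intro exI) auto
qed

section \<open>The value and its two bounds\<close>

text \<open>The quotient is the ceiling of 4n/11; the extra 1 is due where the ceiling would need an
  unattainable weight 1, 2 or 3.\<close>

definition gamma_value :: "nat \<Rightarrow> nat" where
  "gamma_value n = (4 * n + 10) div 11 +
     (if n mod 11 = 8 \<or> 38 \<le> n \<and> n mod 11 \<in> {2, 5} then 1 else 0)"

text \<open>In residues 2 and 5 a start below 38 could cross the threshold, where the extra 1
  appears.\<close>

lemma gamma_value_add:
  assumes "38 \<le> l \<or> l mod 11 \<noteq> 2 \<and> l mod 11 \<noteq> 5"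
  shows "gamma_value (l + 11 * k) = gamma_value l + 4 * k"
proof -
  have "4 * (l + 11 * k) + 10 = 4 * l + 10 + 11 * (4 * k)" by simp
  then have "(4 * (l + 11 * k) + 10) div 11 = (4 * l + 10) div 11 + 4 * k"
    by (simp only: div_mult_self2)
  then show ?thesis using assms by (auto simp: gamma_value_def)
qed

text \<open>The lengths have residues 0 to 10 modulo 11 in order; residues 2 and 5 start beyond the
  threshold, at 46 and 38.\<close>

definition closed_words :: "bool list list" where
  "closed_words =
   [bits [1, 1, 0, 0, 1, 1, 0, 0, 0, 0, 0, 1, 1, 0, 0, 1, 1, 0, 0, 0, 0, 0],
    bits [1, 1, 0, 0, 1, 1, 1, 0, 0, 0, 0, 0, 1, 1, 0, 0, 1, 1, 0, 0, 0, 0, 0],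
    bits [1, 1, 0, 0, 1, 1, 0, 0, 0, 0, 0, 1, 1, 0, 0, 1, 1, 0, 0, 0, 0, 0, 1, 1, 0, 0, 1,
      1, 0, 0, 0, 0, 1, 1, 0, 1, 1, 0, 0, 1, 1, 0, 0, 0, 0, 0],
    bits [1, 1, 0, 1, 1, 0, 0, 1, 1, 0, 0, 0, 0, 0],
    bits [1, 1, 0, 0, 1, 1, 0, 0, 1, 1, 0, 0, 0, 0, 0],
    bits [1, 1, 0, 0, 1, 1, 0, 0, 0, 0, 0, 1, 1, 0, 0, 1, 1, 0, 0, 0, 0, 0, 1, 1, 1, 0, 0,
      1, 1, 0, 0, 1, 1, 0, 0, 0, 0, 0],
    bits [1, 1, 0, 1, 0, 0, 1, 1, 0, 0, 1, 1, 0, 0, 0, 0, 0],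
    bits [1, 1, 0, 1, 0, 0, 0, 1, 1, 0, 0, 1, 1, 0, 0, 0, 0, 0],
    bits [1, 1, 0, 0, 1, 1, 0, 0, 1, 1, 0, 0, 1, 1, 0, 0, 0, 0, 0],
    bits [1, 1, 0, 1, 1, 0, 0, 0, 0, 1, 1, 0, 0, 1, 1, 0, 0, 0, 0, 0],
    bits [1, 1, 0, 0, 1, 1, 0, 0, 0, 0, 1, 1, 0, 0, 1, 1, 0, 0, 0, 0, 0]]"

lemma closed_words:
  "\<forall>w\<in>set closed_words. closed_word w \<and> 13 \<le> length w
     \<and> (38 \<le> length w \<or> length w mod 11 \<noteq> 2 \<and> length w mod 11 \<noteq> 5)
     \<and> length (filter id w) = gamma_value (length w)"
  by code_simp

lemma length_closed_words:
  "map length closed_words = [22, 23, 46, 14, 15, 38, 17, 18, 19, 20, 21]"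
  by code_simp

text \<open>Residue 2 (13, 24, 35) with weight 3 and residue 5 (16, 27) with weight 2. By
  \<open>weight_gap\<close> these words avoid the distinguished window.\<close>

definition sporadic_words :: "bool list list" where
  "sporadic_words =
   [bits [1, 1, 0, 0, 1, 0, 0, 1, 1, 0, 0, 0, 0],
    bits [0, 1, 1, 0, 0, 0, 0, 1, 1, 0, 0, 1, 0, 0, 1, 0],
    bits [1, 0, 0, 1, 1, 0, 0, 0, 0, 1, 1, 0, 0, 1, 0, 0, 0, 1, 1, 1, 0, 0, 0, 0],
    bits [0, 0, 1, 1, 1, 0, 0, 0, 0, 1, 0, 0, 1, 1, 0, 0, 0, 0, 1, 1, 0, 0, 1, 0, 0, 1, 0],
    bits [1, 0, 0, 1, 1, 0, 0, 0, 0, 1, 1, 0, 0, 1, 0, 0, 0, 0, 1, 1, 1, 0, 0, 0, 1, 0, 0,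
      0, 1, 1, 1, 0, 0, 0, 0]]"

lemma sporadic_words:
  "\<forall>w\<in>set sporadic_words. cyclic_word w \<and> 13 \<le> length w
     \<and> length (filter id w) = gamma_value (length w)"
  by code_simp

lemma length_sporadic_words: "map length sporadic_words = [13, 16, 24, 27, 35]"
  by code_simp

lemma has_code_gamma_value:
  assumes "11 \<le> n"
  shows "has_code n (gamma_value n)"
proof -
  let ?L = "[22, 23, 46, 14, 15, 38, 17, 18, 19, 20, 21]"
  have "n \<in> set [11, 12] \<or> n \<in> set [13, 16, 24, 27, 35]
      \<or> (\<exists>l\<in>set ?L. l \<le> n \<and> n mod 11 = l mod 11)"
  \<comment> \<open>46 is the greatest length in \<open>?L\<close>, so from there on every residue
    has a word that is short enough.\<close>
  proof (cases "n < 46")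
    case True
    have "\<forall>n\<in>set [11..<46]. n \<in> set [11, 12] \<or> n \<in> set [13, 16, 24, 27, 35]
        \<or> (\<exists>l\<in>set ?L. l \<le> n \<and> n mod 11 = l mod 11)"
      by code_simp
    moreover have "n \<in> set [11..<46]" using True assms by (simp only: set_upt) simp
    ultimately show ?thesis by (rule bspec)
  next
    case False
    have "\<forall>r\<in>set [0..<11]. \<exists>l\<in>set ?L. l \<le> 46 \<and> r = l mod 11" by code_simp
    moreover have "n mod 11 \<in> set [0..<11]" by (simp only: set_upt) simp
    ultimately obtain l where l: "l \<in> set ?L" "l \<le> 46" "n mod 11 = l mod 11" by blast
    then have "l \<le> n" using False by linarith
    with l show ?thesis by blast
  qed
  then consider "n \<in> set [11, 12]" | "n \<in> set (map length sporadic_words)"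
    | l where "l \<in> set (map length closed_words)" "l \<le> n" "n mod 11 = l mod 11"
    unfolding length_closed_words length_sporadic_words by blast
  then show ?thesis
  proof cases
    case 1
    then show ?thesis using has_code_11 has_code_12 by (auto simp: gamma_value_def)
  next
    case 2
    then show ?thesis using sporadic_words has_code_if_cyclic by fastforce
  next
    case 3
    then obtain w where w: "w \<in> set closed_words" "l = length w" by auto
    obtain k where "n = length w + 11 * k"
      using 3 w by (metis mod_eq_nat1E)
    then show ?thesis using has_code_if_closed[of w k] closed_words w gamma_value_add[of l k] by simp
  qed
qed

text \<open>Every alternative gives \<open>4 * n \<le> 11 * k\<close>. With w = 11k - 4n the third
  one reads 2n \<le> 27w, so weights 1, 2, 3 require n to be at most 13, 27, 40.\<close>

lemma gamma_value_le:
  assumes "11 \<le> n" and "11 * k = 4 * n \<or> 4 * n + 4 \<le> 11 * k \<or> 10 * n \<le> 27 * k"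
  shows "gamma_value n \<le> k"
proof -
  define a r where "a = n div 11" and "r = n mod 11"
  have n: "n = 11 * a + r" by (simp add: a_def r_def)
  consider "r = 8" | "r = 2" | "r = 5" | "r \<noteq> 8" "r \<noteq> 2" "r \<noteq> 5" by blast
  then show ?thesis
  proof cases
    case 1
    have "(4 * n + 10) div 11 = 4 * a + 3" using n 1 by linarith
    then have "gamma_value n = 4 * a + 4" using 1 by (simp add: gamma_value_def r_def)
    moreover have "1 \<le> a" using assms(1) n 1 by linarith
    moreover have "11 * k \<noteq> 44 * a + 32" by presburger
    ultimately show ?thesis using assms(2) n 1 by linarith
  next
    case 2
    have q: "(4 * n + 10) div 11 = 4 * a + 1" using n 2 by linarith
    have ne: "11 * k \<noteq> 44 * a + 8" by presburger
    show ?thesis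
    proof (cases "38 \<le> n")
      case True
      then have "gamma_value n = 4 * a + 2" using q 2 by (simp add: gamma_value_def r_def)
      \<comment> \<open>Residue 2 and \<open>38 \<le> n\<close> force n to be at least 46, past the
        bound 40 for weight 3.\<close>
      moreover have "4 \<le> a" using True n 2 by linarith
      ultimately show ?thesis using assms(2) n 2 ne by linarith
    next
      case False
      then have "gamma_value n = 4 * a + 1" using q 2 by (simp add: gamma_value_def r_def)
      then show ?thesis using assms(2) n 2 by linarith
    qed
  next
    case 3
    have q: "(4 * n + 10) div 11 = 4 * a + 2" using n 3 by linarith
    have ne: "11 * k \<noteq> 44 * a + 20" by presburger
    show ?thesis
    proof (cases "38 \<le> n")
      case True
      then have "gamma_value n = 4 * a + 3" using q 3 by (simp add: gamma_value_def r_def)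
      moreover have "3 \<le> a" using True n 3 by linarith
      ultimately show ?thesis using assms(2) n 3 ne by linarith
    next
      case False
      then have "gamma_value n = 4 * a + 2" using q 3 by (simp add: gamma_value_def r_def)
      then show ?thesis using assms(2) n 3 by linarith
    qed
  next
    case 4
    then have "gamma_value n = (4 * n + 10) div 11" by (simp add: gamma_value_def r_def)
    then show ?thesis using assms(2) by linarith
  qed
qed

lemma gamma_value_le_card:
  assumes "11 \<le> n" and id: "identifying_code (circ_verts n) (circ_adj n) C"
  shows "gamma_value n \<le> card C"
proof -
  have C: "C \<subseteq> circ_verts n" using id by (simp add: identifying_code_def)
  have "separating (code_seq n C)" using separating_if_identifying[OF _ id] assms(1) by simp
  from periodic_weight[OF this code_seq_periodic] card_code_seq[OF C]
  have "11 * int (card C) = 4 * int n \<or> 4 * int n + 4 \<le> 11 * int (card C)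
    \<or> 10 * int n \<le> 27 * int (card C)" by simp
  then show ?thesis using assms(1) by (intro gamma_value_le) linarith+
qed

lemma gamma_ID_circ:
  assumes "11 \<le> n"
  shows "gamma_ID (circ_verts n) (circ_adj n) = gamma_value n"
  unfolding gamma_ID_def
proof (rule Least_equality)
  obtain C where C: "identifying_code (circ_verts n) (circ_adj n) C" "card C = gamma_value n"
    using has_code_gamma_value[OF assms] by (auto simp: has_code_def)
  moreover have "finite C"
    using C(1) finite_subset[of C "circ_verts n"] by (auto simp: identifying_code_def circ_verts_def)
  ultimately show "\<exists>C. identifying_code (circ_verts n) (circ_adj n) C \<and> finite C
      \<and> card C = gamma_value n"
    by blast
qed (use gamma_value_le_card[OF assms] in blast)

lemma ceiling_four_elevenths: "\<lceil>4 * real n / 11\<rceil> = int ((4 * n + 10) div 11)"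
proof -
  define q where "q = (4 * n + 10) div 11"
  have "11 * q \<le> 4 * n + 10" "4 * n + 10 < 11 * q + 11" unfolding q_def by simp_all
  then have "11 * real q \<le> 4 * real n + 10" "4 * real n < 11 * real q + 1" by linarith+
  moreover from \<open>4 * n + 10 < 11 * q + 11\<close> have "4 * n \<le> 11 * q" by simp
  then have "4 * real n \<le> 11 * real q" by linarith
  ultimately show ?thesis unfolding q_def[symmetric] by (intro ceiling_unique) (auto simp: field_simps)
qed

theorem theorem6:
  fixes n :: nat
  assumes "n \<ge> 11"
  shows
    "(n \<le> 37 \<longrightarrow>
        ([n = 8] (mod 11) \<longrightarrow>
           int (gamma_ID (circ_verts n) (circ_adj n)) = \<lceil>4 * real n / 11\<rceil> + 1) \<and>
        (\<not> [n = 8] (mod 11) \<longrightarrow>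
           int (gamma_ID (circ_verts n) (circ_adj n)) = \<lceil>4 * real n / 11\<rceil>)) \<and>
     (n \<ge> 38 \<longrightarrow>
        ([n = 2] (mod 11) \<or> [n = 5] (mod 11) \<or> [n = 8] (mod 11) \<longrightarrow>
           int (gamma_ID (circ_verts n) (circ_adj n)) = \<lceil>4 * real n / 11\<rceil> + 1) \<and>
        (\<not> ([n = 2] (mod 11) \<or> [n = 5] (mod 11) \<or> [n = 8] (mod 11)) \<longrightarrow>
           int (gamma_ID (circ_verts n) (circ_adj n)) = \<lceil>4 * real n / 11\<rceil>))"
proof -
  obtain q where "\<lceil>4 * real n / 11\<rceil> = int q"
    and "gamma_ID (circ_verts n) (circ_adj n) =
      q + (if n mod 11 = 8 \<or> 38 \<le> n \<and> n mod 11 \<in> {2, 5} then 1 else 0)"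
    using gamma_ID_circ[OF assms] ceiling_four_elevenths[of n] unfolding gamma_value_def by blast
  then show ?thesis by (auto simp: cong_def)
qed

end
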